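(* Let $C=(c_{ij})$ and $C'=(c'_{ij})$ be real $n\times n$ matrices with row-sum vectors $(r_1,\ldots,r_n)$ and $(r'_1,\ldots,r'_n)$ respectively. Assume: (i) $c_{ij}\leq c'_{ij}$ for all $1\leq i\leq n$, $1\leq j\leq n-1$, and $r_i\leq r'_i$ for all $1\leq i\leq n$; (ii) $C'$ has a rooted eigenvector $v'=(v'_1,\ldots,v'_n)^T$ for an eigenvalue $\lambda'\in\mathbb{R}$; (iii) $C$ has a nonnegative left eigenvector $v^T=(v_1,\ldots,v_n)$ for an eigenvalue $\lambda\in\mathbb{R}$; (iv) $v^Tv'>0$. Then $\lambda\leq\lambda'$. Moreover, $\lambda=\lambda'$ if and only if both of the following hold: (a) if $v'_n\neq 0$, then $r_i=r'_i$ for all $1\le i\le n$ with $v_i\neq0$; (b) $c'_{ij}=c_{ij}$ for all $1\leq i\leq n$, $1\leq j\leq n-1$ with $v_i\neq 0$ and $v'_j>v'_n$.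
   Context: A real vector $(v_1,\ldots,v_n)$ is rooted if $v_i\geq v_n\geq 0$ for all $1\leq i\leq n-1$. The row-sum vector of a matrix is the vector of its row sums. *)

theory Defs
  imports "Jordan_Normal_Form.Char_Poly"
begin

text \<open>Vectors and matrices are indexed from 0, so the last entry of a vector \<open>v\<close> of
  dimension \<open>n\<close> is \<open>v $ (n - 1)\<close>.\<close>

definition rooted :: "real vec \<Rightarrow> bool" where
  "rooted v \<longleftrightarrow> 0 < dim_vec v
     \<and> (\<forall>i < dim_vec v - 1. v $ (dim_vec v - 1) \<le> v $ i)
     \<and> 0 \<le> v $ (dim_vec v - 1)"

definition row_sum_vec :: "real mat \<Rightarrow> real vec" where
  "row_sum_vec A = vec (dim_row A) (\<lambda>i. \<Sum>j < dim_col A. A $$ (i, j))"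

definition left_eigenvector :: "real mat \<Rightarrow> real vec \<Rightarrow> real \<Rightarrow> bool" where
  "left_eigenvector A v k \<longleftrightarrow> v \<in> carrier_vec (dim_row A) \<and> v \<noteq> 0\<^sub>v (dim_row A)
     \<and> mat_of_row v * A = k \<cdot>\<^sub>m mat_of_row v"

lemma left_eigenvector_transpose:
  assumes "A \<in> carrier_mat n n"
  shows "left_eigenvector A v k \<longleftrightarrow> eigenvector (transpose_mat A) v k"
proof -
  have "mat_of_row v * A = k \<cdot>\<^sub>m mat_of_row v \<longleftrightarrow> transpose_mat A *\<^sub>v v = k \<cdot>\<^sub>v v"
    if v: "v \<in> carrier_vec n"
  proof -
    have "mat_of_row v * A = k \<cdot>\<^sub>m mat_of_row v \<longleftrightarrow> (\<forall>j<n. v \<bullet> col A j = k * v $ j)"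
      using assms v by (auto simp: mat_eq_iff)
    also have "\<dots> \<longleftrightarrow> (\<forall>j<n. col A j \<bullet> v = k * v $ j)"
      using assms v by (metis carrier_matD(1) col_dim comm_scalar_prod)
    also have "\<dots> \<longleftrightarrow> transpose_mat A *\<^sub>v v = k \<cdot>\<^sub>v v"
      using assms v by (auto simp: vec_eq_iff)
    finally show ?thesis .
  qed
  then show ?thesis
    using assms by (auto simp: left_eigenvector_def eigenvector_def)
qed

end

theory Submission
  imports Defs
begin

text \<open>Pairing \<open>C' v' = l' v'\<close> with \<open>v\<close> and \<open>v\<^sup>T C = l v\<^sup>T\<close> with \<open>v'\<close> gives
  \<open>(l' - l) (v \<bullet> v') = v \<bullet> ((C' - C) v')\<close>. The rooted vector \<open>v'\<close> is its last entry times the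
  all-ones vector plus a nonnegative remainder that vanishes in the last coordinate. So every entry
  of \<open>(C' - C) v'\<close> combines a row sum of \<open>C' - C\<close> and entries of \<open>C' - C\<close> outside the last column,
  all nonnegative, with nonnegative coefficients. Hence \<open>l \<le> l'\<close>, and equality holds exactly when
  every term with \<open>v\<^sub>i \<noteq> 0\<close> vanishes.\<close>

lemma scalar_prod_nonneg:
  fixes u w :: "'a :: ordered_semiring_0 vec"
  assumes "0\<^sub>v n \<le> u" and "0\<^sub>v n \<le> w"
  shows "0 \<le> u \<bullet> w"
  using assms by (auto simp: scalar_prod_def less_eq_vec_def intro!: sum_nonneg mult_nonneg_nonneg)

lemma scalar_prod_nonneg_eq_0_iff:
  fixes u w :: "'a :: linordered_semidom vec"
  assumes u: "0\<^sub>v n \<le> u" and w: "0\<^sub>v n \<le> w"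
  shows "u \<bullet> w = 0 \<longleftrightarrow> (\<forall>i<n. u $ i \<noteq> 0 \<longrightarrow> w $ i = 0)"
proof -
  have "u \<bullet> w = (\<Sum>i<n. u $ i * w $ i)"
    using w by (simp add: scalar_prod_def less_eq_vec_def lessThan_atLeast0)
  also have "\<dots> = 0 \<longleftrightarrow> (\<forall>i<n. u $ i * w $ i = 0)"
    using u w by (subst sum_nonneg_eq_0_iff) (auto simp: less_eq_vec_def)
  finally show ?thesis
    by auto
qed

lemma scalar_prod_split_last:
  fixes a w :: "'a :: ring vec"
  assumes "w \<in> carrier_vec n" and "0 < n"
  shows "a \<bullet> w = (\<Sum>j<n-1. a $ j * (w $ j - w $ (n-1))) + (\<Sum>j<n. a $ j) * w $ (n-1)"
proof -
  obtain m where "n = Suc m"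
    using \<open>0 < n\<close> by (cases n) auto
  moreover have "a \<bullet> w = (\<Sum>j<n. a $ j * w $ j)"
    using assms(1) by (simp add: scalar_prod_def lessThan_atLeast0)
  ultimately show ?thesis
    by (simp add: algebra_simps sum_subtractf sum_distrib_right)
qed

context
  fixes a w :: "real vec" and n :: nat
  assumes w_dim: "w \<in> carrier_vec n" and w_rooted: "rooted w"
    and entries_nonneg: "\<And>j. j < n - 1 \<Longrightarrow> 0 \<le> a $ j" and total_nonneg: "0 \<le> (\<Sum>j<n. a $ j)"
begin

private lemma rooted_terms_nonneg:
  shows "j < n - 1 \<Longrightarrow> 0 \<le> a $ j * (w $ j - w $ (n-1))"
    and "0 \<le> (\<Sum>j<n. a $ j) * w $ (n-1)"
  using w_dim w_rooted entries_nonneg total_nonneg by (auto simp: rooted_def)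

private lemma scalar_prod_rooted:
  "a \<bullet> w = (\<Sum>j<n-1. a $ j * (w $ j - w $ (n-1))) + (\<Sum>j<n. a $ j) * w $ (n-1)"
  using w_dim w_rooted by (intro scalar_prod_split_last) (auto simp: rooted_def)

lemma scalar_prod_rooted_nonneg: "0 \<le> a \<bullet> w"
  unfolding scalar_prod_rooted
  by (intro add_nonneg_nonneg sum_nonneg rooted_terms_nonneg) simp

lemma scalar_prod_rooted_eq_0_iff:
  "a \<bullet> w = 0 \<longleftrightarrow>
    (w $ (n-1) \<noteq> 0 \<longrightarrow> (\<Sum>j<n. a $ j) = 0) \<and> (\<forall>j<n-1. w $ (n-1) < w $ j \<longrightarrow> a $ j = 0)"
proof -
  have "a \<bullet> w = 0 \<longleftrightarrow>
      (\<Sum>j<n-1. a $ j * (w $ j - w $ (n-1))) = 0 \<and> (\<Sum>j<n. a $ j) * w $ (n-1) = 0"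
    unfolding scalar_prod_rooted
    by (intro add_nonneg_eq_0_iff sum_nonneg rooted_terms_nonneg) simp
  also have "(\<Sum>j<n-1. a $ j * (w $ j - w $ (n-1))) = 0 \<longleftrightarrow>
      (\<forall>j<n-1. a $ j * (w $ j - w $ (n-1)) = 0)"
    using rooted_terms_nonneg(1) by (subst sum_nonneg_eq_0_iff) auto
  also have "\<dots> \<longleftrightarrow> (\<forall>j<n-1. w $ (n-1) < w $ j \<longrightarrow> a $ j = 0)"
    using w_dim w_rooted by (force simp: rooted_def)
  finally show ?thesis
    by auto
qed

end

lemma eigenvalue_diff_scalar_prod:
  fixes A B :: "'a :: comm_ring_1 mat"
  assumes A: "A \<in> carrier_mat n n" and B: "B \<in> carrier_mat n n"
    and v: "eigenvector (transpose_mat A) v k" and w: "eigenvector B w m"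
  shows "(m - k) * (v \<bullet> w) = v \<bullet> ((B - A) *\<^sub>v w)"
proof -
  have v_dim: "v \<in> carrier_vec n" and vA: "transpose_mat A *\<^sub>v v = k \<cdot>\<^sub>v v"
    using v A by (auto simp: eigenvector_def)
  have w_dim: "w \<in> carrier_vec n" and Bw: "B *\<^sub>v w = m \<cdot>\<^sub>v w"
    using w B by (auto simp: eigenvector_def)
  have "v \<bullet> (B *\<^sub>v w) = m * (v \<bullet> w)"
    using Bw v_dim w_dim by simp
  moreover have "v \<bullet> (A *\<^sub>v w) = k * (v \<bullet> w)"
    using transpose_vec_mult_scalar[OF A w_dim v_dim] vA v_dim w_dim by simp
  moreover have "v \<bullet> ((B - A) *\<^sub>v w) = v \<bullet> (B *\<^sub>v w) - v \<bullet> (A *\<^sub>v w)"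
    using A B v_dim w_dim
    by (simp add: minus_mult_distrib_mat_vec[OF B A] scalar_prod_minus_distrib[of _ n])
  ultimately show ?thesis
    by (simp add: left_diff_distrib)
qed

lemma sum_row_minus_eq_row_sum_vec:
  assumes "A \<in> carrier_mat n m" and "B \<in> carrier_mat n m" and "i < n"
  shows "(\<Sum>j<m. row (A - B) i $ j) = row_sum_vec A $ i - row_sum_vec B $ i"
  using assms by (simp add: row_sum_vec_def sum_subtractf)

theorem theorem3p4:
  fixes n :: nat and C C' :: "real mat" and r r' v v' :: "real vec" and l l' :: real
  assumes n: "1 \<le> n"
    and C: "C \<in> carrier_mat n n" and C': "C' \<in> carrier_mat n n"
    and r: "r = row_sum_vec C" and r': "r' = row_sum_vec C'"
    and entries_le: "\<forall>i<n. \<forall>j<n-1. C $$ (i, j) \<le> C' $$ (i, j)"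
    and row_sums_le: "\<forall>i<n. r $ i \<le> r' $ i"
    and v'_eigen: "eigenvector C' v' l'" and v'_rooted: "rooted v'"
    and v_eigen: "left_eigenvector C v l" and v_nonneg: "\<forall>i<n. 0 \<le> v $ i"
    and vv'_pos: "v \<bullet> v' > 0"
  shows "l \<le> l' \<and>
    (l = l' \<longleftrightarrow>
      (v' $ (n-1) \<noteq> 0 \<longrightarrow> (\<forall>i<n. v $ i \<noteq> 0 \<longrightarrow> r $ i = r' $ i)) \<and>
      (\<forall>i<n. \<forall>j<n-1. v $ i \<noteq> 0 \<and> v' $ j > v' $ (n-1) \<longrightarrow> C' $$ (i, j) = C $$ (i, j)))"
proof -
  let ?D = "C' - C"
  have v: "0\<^sub>v n \<le> v" and v': "v' \<in> carrier_vec n"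
    using v_eigen v_nonneg v'_eigen C C'
    by (auto simp: left_eigenvector_def eigenvector_def less_eq_vec_def)
  have row_sum: "(\<Sum>j<n. row ?D i $ j) = r' $ i - r $ i" if "i < n" for i
    using sum_row_minus_eq_row_sum_vec[OF C' C that] by (simp only: r r')
  have Dv'_nonneg: "0\<^sub>v n \<le> ?D *\<^sub>v v'"
    using scalar_prod_rooted_nonneg[OF v' v'_rooted] C C' entries_le row_sums_le row_sum
    by (auto simp: less_eq_vec_def)
  have diff: "(l' - l) * (v \<bullet> v') = v \<bullet> (?D *\<^sub>v v')"
    using eigenvalue_diff_scalar_prod[OF C C' _ v'_eigen] v_eigen left_eigenvector_transpose[OF C]
    by blast
  have "l \<le> l'"
    using scalar_prod_nonneg[OF v Dv'_nonneg] vv'_pos by (simp add: zero_le_mult_iff flip: diff)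
  moreover have "l = l' \<longleftrightarrow> (\<forall>i<n. v $ i \<noteq> 0 \<longrightarrow> row ?D i \<bullet> v' = 0)"
    using scalar_prod_nonneg_eq_0_iff[OF v Dv'_nonneg] vv'_pos C by (auto simp flip: diff)
  moreover have "row ?D i \<bullet> v' = 0 \<longleftrightarrow> (v' $ (n-1) \<noteq> 0 \<longrightarrow> r $ i = r' $ i) \<and>
      (\<forall>j<n-1. v' $ j > v' $ (n-1) \<longrightarrow> C' $$ (i, j) = C $$ (i, j))" if "i < n" for i
    using scalar_prod_rooted_eq_0_iff[OF v' v'_rooted, of "row ?D i"] that C C' entries_le row_sums_le
      row_sum[OF that] by auto
  ultimately show ?thesis
    by blast
qed

end
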